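(* Let $Q\subseteq\mathrm{Prob}(A)$ and $\mathcal{P}_s\subseteq\{A\to\mathrm{Prob}(S)\}$, $s\in S$, be arbitrary (nonempty) sets. The following are equivalent: (1) The solutions $v_\gamma^*:S\to\mathbb{R}$, $\gamma\in(0,1)$, of the $\gamma$-discounted robust Bellman equations $$v_\gamma^*(s)=\sup_{\phi\in Q}\inf_{p_s\in\mathcal{P}_s}\sum_{a\in A}\sum_{s'\in S}\phi(a)p_s(s'|a)\big[r(s,a)+\gamma v_\gamma^*(s')\big]\qquad\forall s\in S$$ have uniformly bounded span, i.e. $\sup_{\gamma\in(0,1)}\big[\max_{s\in S}v_\gamma^*(s)-\min_{s\in S}v_\gamma^*(s)\big]<\infty$. (2) The constant-gain average-reward robust Bellman equation $$u^*(s)=\sup_{\phi\in Q}\inf_{p_s\in\mathcal{P}_s}\sum_{a\in A}\sum_{s'\in S}\phi(a)p_s(s'|a)\big[r(s,a)-\alpha^*+u^*(s')\big]\qquad\forall s\in S$$ has a solution $(u^*,\alpha^* )$ with $u^*:S\to\mathbb{R}$ and $\alpha^*\in[0,1]$.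
   Context: $S$ (states) and $A$ (actions) are finite nonempty sets; $\mathrm{Prob}(E)$ is the set of probability distributions on a finite set $E$; $r:S\times A\to[0,1]$ is a reward function. Elements $p_s\in\mathcal{P}_s$ are maps $A\to\mathrm{Prob}(S)$, written $p_s(s'|a)$. For each $\gamma\in(0,1)$ the discounted equation has exactly one solution $v_\gamma^*$ (by contraction). *)

theory Defs
  imports "HOL-Probability.Probability"
begin

text \<open>
  States and actions are the elements of two finite types. The suprema and infima below
  are those of the conditionally complete lattice of reals; for nonempty \<open>Q\<close> and \<open>P s\<close> they
  range over nonempty bounded sets of reals, since the summed quantities take only finitely
  many values and the weights \<open>pmf \<phi> a * pmf (p a) s'\<close> are nonnegative with total mass 1.
\<close>

definition discounted_solution ::
  "'a::finite pmf set \<Rightarrow> ('s::finite \<Rightarrow> ('a \<Rightarrow> 's pmf) set) \<Rightarrow> ('s \<Rightarrow> 'a \<Rightarrow> real)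
    \<Rightarrow> real \<Rightarrow> ('s \<Rightarrow> real) \<Rightarrow> bool" where
  "discounted_solution Q P r \<gamma> v \<longleftrightarrow>
     (\<forall>s. v s = (SUP \<phi>\<in>Q. INF p\<in>P s.
        \<Sum>a\<in>UNIV. \<Sum>s'\<in>UNIV. pmf \<phi> a * pmf (p a) s' * (r s a + \<gamma> * v s')))"

text \<open>
  For nonempty \<open>Q\<close>, \<open>P s\<close> and \<open>0 < \<gamma> < 1\<close> the right-hand side of the discounted equation is a
  \<open>\<gamma>\<close>-contraction in the maximum norm, so the description below is proper.
\<close>

definition discounted_value ::
  "'a::finite pmf set \<Rightarrow> ('s::finite \<Rightarrow> ('a \<Rightarrow> 's pmf) set) \<Rightarrow> ('s \<Rightarrow> 'a \<Rightarrow> real)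
    \<Rightarrow> real \<Rightarrow> 's \<Rightarrow> real" where
  "discounted_value Q P r \<gamma> = (THE v. discounted_solution Q P r \<gamma> v)"

definition span_seminorm :: "('s::finite \<Rightarrow> real) \<Rightarrow> real" where
  "span_seminorm v = Max (range v) - Min (range v)"

definition average_solution ::
  "'a::finite pmf set \<Rightarrow> ('s::finite \<Rightarrow> ('a \<Rightarrow> 's pmf) set) \<Rightarrow> ('s \<Rightarrow> 'a \<Rightarrow> real)
    \<Rightarrow> ('s \<Rightarrow> real) \<Rightarrow> real \<Rightarrow> bool" where
  "average_solution Q P r u \<alpha> \<longleftrightarrow>
     (\<forall>s. u s = (SUP \<phi>\<in>Q. INF p\<in>P s.
        \<Sum>a\<in>UNIV. \<Sum>s'\<in>UNIV. pmf \<phi> a * pmf (p a) s' * (r s a - \<alpha> + u s')))"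

end

theory Submission
  imports Defs
begin

text \<open>
  Both equations are fixed point equations for one operator. With
  \<open>T w s\<close> the sup-inf of the expectation of \<open>r s a + w s'\<close>, the discounted equation reads
  \<open>v = T (\<gamma> v)\<close> and the average-reward equation reads \<open>u = T (u - \<alpha>)\<close>. The structure of \<open>Q\<close>
  and \<open>P s\<close> matters only through two facts about \<open>T\<close>: raising the argument by at most a
  constant raises the value by at most that constant, and \<open>T 0\<close> lies between \<open>0\<close> and \<open>1\<close>.
  Operators with these two properties are treated in the locale \<open>topical_operator\<close>.

  A comparison principle holds for the discounted equation (\<open>sub_le_super\<close>): every subsolution
  lies below every supersolution. Uniqueness and the bounds \<open>0 \<le> v \<le> 1 / (1 - \<gamma>)\<close> follow from it;
  existence follows by monotone iteration from \<open>0\<close>.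

  From an average-reward solution \<open>(u, \<alpha>)\<close> one gets the supersolution
  \<open>u + \<alpha> / (1 - \<gamma>) - min u\<close> and the subsolution \<open>u + \<alpha> / (1 - \<gamma>) - max u\<close> for every discount
  factor. They trap \<open>v\<close>, so its span is at most twice that of \<open>u\<close>.

  Conversely, put \<open>m = min v\<close>. Since \<open>T\<close> commutes with adding constants, \<open>v - m\<close> solves
  \<open>h = T (\<gamma> h - (1 - \<gamma>) m)\<close>. If the spans are bounded, the relative values \<open>v - m\<close> and the gains
  \<open>(1 - \<gamma>) m\<close> stay in a compact set as \<open>\<gamma>\<close> tends to \<open>1\<close>, and any limit point solves the
  average-reward equation because \<open>T\<close> is continuous.
\<close>

section \<open>Topical operators and their discounted equation\<close>

text \<open>
  The single hypothesis \<open>topical\<close> contains monotonicity (\<open>c = 0\<close>), equivariance under adding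
  constants, and nonexpansiveness in the maximum norm.
\<close>

locale topical_operator =
  fixes T :: "('s::finite \<Rightarrow> real) \<Rightarrow> 's \<Rightarrow> real"
  assumes topical: "(\<And>s. w s \<le> w' s + c) \<Longrightarrow> T w s \<le> T w' s + c"
    and at_zero: "T (\<lambda>_. 0) s \<in> {0..1}"
begin

lemma mono: "(\<And>s. w s \<le> w' s) \<Longrightarrow> T w s \<le> T w' s"
  using topical[of w w' 0 s] by simp

lemma add_const: "T (\<lambda>s. w s + c) s = T w s + c"
proof (rule antisym)
  show "T (\<lambda>s. w s + c) s \<le> T w s + c"
    by (rule topical) simp
  have "T w s \<le> T (\<lambda>s. w s + c) s + (- c)"
    by (rule topical) simp
  then show "T w s + c \<le> T (\<lambda>s. w s + c) s"
    by simp
qed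

lemma tendsto_pointwise:
  assumes "\<And>s. (\<lambda>n. w n s) \<longlonglongrightarrow> w' s"
  shows "(\<lambda>n. T (w n) s) \<longlonglongrightarrow> T w' s"
proof -
  let ?d = "\<lambda>n. \<Sum>s\<in>UNIV. \<bar>w n s - w' s\<bar>"
  have le: "\<bar>w n s - w' s\<bar> \<le> ?d n" for n s
    by (rule member_le_sum) auto
  have "T (w n) s \<le> T w' s + ?d n" "T w' s \<le> T (w n) s + ?d n" for n
    using le[of n] by (auto intro!: topical simp: abs_le_iff algebra_simps)
  then have dist: "\<bar>T (w n) s - T w' s\<bar> \<le> ?d n" for n
    by (simp add: abs_le_iff algebra_simps)
  have "(\<lambda>n. \<bar>w n s - w' s\<bar>) \<longlonglongrightarrow> 0" for s
    using assms[of s] by (simp add: LIM_zero tendsto_rabs_zero)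
  then have "?d \<longlonglongrightarrow> 0"
    by (intro tendsto_null_sum) auto
  then have "(\<lambda>n. T (w n) s - T w' s) \<longlonglongrightarrow> 0"
    by (rule Lim_null_comparison[rotated]) (use dist in simp)
  then show ?thesis
    by (rule LIM_zero_cancel)
qed

text \<open>
  Let \<open>d\<close> be the largest excess of the subsolution over the supersolution. One application of
  \<open>T\<close> after discounting shows that the excess is at most \<open>\<gamma> d\<close>, which forces \<open>d \<le> 0\<close>.
\<close>

lemma sub_le_super:
  assumes \<gamma>: "0 < \<gamma>" "\<gamma> < 1"
    and sub: "\<And>s. v s \<le> T (\<lambda>s'. \<gamma> * v s') s"
    and super: "\<And>s. T (\<lambda>s'. \<gamma> * w s') s \<le> w s"
  shows "v s \<le> w s"
proof -
  define d where "d = Max (range (\<lambda>s. v s - w s))"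
  have d: "v s - w s \<le> d" for s
    unfolding d_def by (rule Max_ge) auto
  have "d \<in> range (\<lambda>s. v s - w s)"
    unfolding d_def by (rule Max_in) auto
  then obtain t where t: "d = v t - w t"
    by auto
  have "\<gamma> * v s \<le> \<gamma> * w s + \<gamma> * d" for s
    using mult_left_mono[OF d[of s], of \<gamma>] \<gamma> by (simp add: algebra_simps)
  then have "T (\<lambda>s'. \<gamma> * v s') t \<le> T (\<lambda>s'. \<gamma> * w s') t + \<gamma> * d"
    by (rule topical)
  with sub[of t] super[of t] t have "(1 - \<gamma>) * d \<le> 0"
    by (simp add: algebra_simps)
  with \<gamma> have "d \<le> 0"
    by (simp add: mult_le_0_iff)
  with d[of s] show ?thesis
    by simp
qed

lemma zero_subsolution: "0 \<le> T (\<lambda>_. \<gamma> * 0) s"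
  using at_zero[of s] by simp

lemma const_supersolution:
  assumes "\<gamma> < 1"
  shows "T (\<lambda>_. \<gamma> * (1 / (1 - \<gamma>))) s \<le> 1 / (1 - \<gamma>)"
proof -
  have "T (\<lambda>_. \<gamma> * (1 / (1 - \<gamma>))) s = T (\<lambda>_. 0) s + \<gamma> * (1 / (1 - \<gamma>))"
    using add_const[of "\<lambda>_. 0" "\<gamma> * (1 / (1 - \<gamma>))" s] by simp
  also have "\<dots> \<le> 1 + \<gamma> * (1 / (1 - \<gamma>))"
    using at_zero[of s] by simp
  also have "\<dots> = 1 / (1 - \<gamma>)"
    using assms by (simp add: field_simps)
  finally show ?thesis .
qed

lemma discounted_bounds:
  assumes \<gamma>: "0 < \<gamma>" "\<gamma> < 1"
    and fp: "\<And>s. v s = T (\<lambda>s'. \<gamma> * v s') s"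
  shows "0 \<le> v s" "v s \<le> 1 / (1 - \<gamma>)"
proof -
  have sub: "\<And>s. v s \<le> T (\<lambda>s'. \<gamma> * v s') s" and super: "\<And>s. T (\<lambda>s'. \<gamma> * v s') s \<le> v s"
    by (rule eq_refl, rule fp) (rule eq_refl, rule fp[symmetric])
  show "0 \<le> v s"
    by (rule sub_le_super[OF \<gamma> _ super, of "\<lambda>_. 0"]) (rule zero_subsolution)
  show "v s \<le> 1 / (1 - \<gamma>)"
    by (rule sub_le_super[OF \<gamma> sub, of "\<lambda>_. 1 / (1 - \<gamma>)"]) (rule const_supersolution[OF \<gamma>(2)])
qed

lemma discounted_unique:
  assumes "0 < \<gamma>" "\<gamma> < 1"
    and v: "\<And>s. v s = T (\<lambda>s'. \<gamma> * v s') s"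
    and w: "\<And>s. w s = T (\<lambda>s'. \<gamma> * w s') s"
  shows "v = w"
proof
  fix s
  show "v s = w s"
    by (rule antisym; rule sub_le_super[OF assms(1,2)]; rule eq_refl)
      (rule v w v[symmetric] w[symmetric])+
qed

text \<open>
  Value iteration started at \<open>0\<close> increases, because \<open>0\<close> is a subsolution and \<open>T\<close> is monotone, and
  it stays below the constant supersolution. Its limit is a fixed point by continuity.
\<close>

lemma discounted_exists:
  assumes \<gamma>: "0 < \<gamma>" "\<gamma> < 1"
  shows "\<exists>v. \<forall>s. v s = T (\<lambda>s'. \<gamma> * v s') s"
proof -
  define x where "x n = ((\<lambda>v. T (\<lambda>s'. \<gamma> * v s')) ^^ n) (\<lambda>_. 0)" for n
  have x_Suc: "x (Suc n) = T (\<lambda>s'. \<gamma> * x n s')" and x_0: "x 0 = (\<lambda>_. 0)" for n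
    by (simp_all add: x_def)
  have step: "x n s \<le> x (Suc n) s" for n s
  proof (induction n arbitrary: s)
    case 0
    show ?case
      using zero_subsolution[of \<gamma> s] by (simp add: x_Suc x_0)
  next
    case (Suc n)
    have "T (\<lambda>s'. \<gamma> * x n s') s \<le> T (\<lambda>s'. \<gamma> * x (Suc n) s') s"
      by (rule mono) (use Suc \<gamma> in simp)
    then show ?case
      by (simp only: x_Suc)
  qed
  have bound: "x n s \<le> 1 / (1 - \<gamma>)" for n s
  proof (induction n arbitrary: s)
    case 0
    show ?case
      using \<gamma> by (simp add: x_0)
  next
    case (Suc n)
    have "T (\<lambda>s'. \<gamma> * x n s') s \<le> T (\<lambda>_. \<gamma> * (1 / (1 - \<gamma>))) s"
      by (rule mono, rule mult_left_mono) (use Suc \<gamma> in auto)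
    also have "\<dots> \<le> 1 / (1 - \<gamma>)"
      by (rule const_supersolution[OF \<gamma>(2)])
    finally show ?case
      by (simp only: x_Suc)
  qed
  have "\<exists>l. (\<lambda>n. x n s) \<longlonglongrightarrow> l" for s
    using incseq_convergent[of "\<lambda>n. x n s"] step bound by (metis incseq_SucI)
  then obtain v where v: "\<And>s. (\<lambda>n. x n s) \<longlonglongrightarrow> v s"
    by metis
  have "v s = T (\<lambda>s'. \<gamma> * v s') s" for s
  proof (rule LIMSEQ_unique)
    show "(\<lambda>n. x (Suc n) s) \<longlonglongrightarrow> v s"
      using v by (rule LIMSEQ_Suc)
    show "(\<lambda>n. x (Suc n) s) \<longlonglongrightarrow> T (\<lambda>s'. \<gamma> * v s') s"
      unfolding x_Suc by (intro tendsto_pointwise tendsto_intros v)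
  qed
  then show ?thesis
    by blast
qed

section \<open>Average-reward solutions and bounded span\<close>

text \<open>
  Translating \<open>u\<close> by \<open>\<alpha> / (1 - \<gamma>) - k\<close> costs the error \<open>(1 - \<gamma>) (u - k)\<close> in the discounted
  equation. Its sign is constant for \<open>k = min u\<close> and for \<open>k = max u\<close>.
\<close>

lemma span_discounted_le:
  assumes \<gamma>: "0 < \<gamma>" "\<gamma> < 1"
    and v: "\<And>s. v s = T (\<lambda>s'. \<gamma> * v s') s"
    and u: "\<And>s. u s = T (\<lambda>s'. u s' - \<alpha>) s"
  shows "span_seminorm v \<le> 2 * span_seminorm u"
proof -
  define m where "m = Min (range u)"
  define M where "M = Max (range u)"
  have m: "m \<le> u s" and M: "u s \<le> M" for s
    unfolding m_def M_def by auto
  define g where "g = \<alpha> / (1 - \<gamma>)"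
  have g: "g = \<alpha> + \<gamma> * g"
    using \<gamma> by (simp add: g_def field_simps)
  have upper: "v s \<le> u s + (g - m)" for s
  proof (rule sub_le_super[OF \<gamma>, of v "\<lambda>s. u s + (g - m)"])
    fix s
    show "v s \<le> T (\<lambda>s'. \<gamma> * v s') s"
      using v[of s] by simp
    have "\<gamma> * (u s' + (g - m)) \<le> (u s' - \<alpha>) + (g - m)" for s'
      using mult_nonneg_nonneg[of "1 - \<gamma>" "u s' - m"] m[of s'] \<gamma> g by (simp add: algebra_simps)
    then have "T (\<lambda>s'. \<gamma> * (u s' + (g - m))) s \<le> T (\<lambda>s'. u s' - \<alpha>) s + (g - m)"
      by (rule topical)
    then show "T (\<lambda>s'. \<gamma> * (u s' + (g - m))) s \<le> u s + (g - m)"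
      by (simp flip: u)
  qed
  have lower: "u s + (g - M) \<le> v s" for s
  proof (rule sub_le_super[OF \<gamma>, of "\<lambda>s. u s + (g - M)" v])
    fix s
    show "T (\<lambda>s'. \<gamma> * v s') s \<le> v s"
      using v[of s] by simp
    have "u s' - \<alpha> \<le> \<gamma> * (u s' + (g - M)) + (M - g)" for s'
      using mult_nonneg_nonneg[of "1 - \<gamma>" "M - u s'"] M[of s'] \<gamma> g by (simp add: algebra_simps)
    then have "T (\<lambda>s'. u s' - \<alpha>) s \<le> T (\<lambda>s'. \<gamma> * (u s' + (g - M))) s + (M - g)"
      by (rule topical)
    then show "u s + (g - M) \<le> T (\<lambda>s'. \<gamma> * (u s' + (g - M))) s"
      by (simp flip: u)
  qed
  have "v s \<le> M + (g - m)" for s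
    using upper[of s] M[of s] by linarith
  then have "Max (range v) \<le> M + (g - m)"
    by (intro Max.boundedI) auto
  moreover have "m + (g - M) \<le> v s" for s
    using lower[of s] m[of s] by linarith
  then have "m + (g - M) \<le> Min (range v)"
    by (intro Min.boundedI) auto
  ultimately have "span_seminorm v \<le> (M + (g - m)) - (m + (g - M))"
    unfolding span_seminorm_def by (rule diff_mono)
  also have "\<dots> = 2 * (M - m)"
    by simp
  finally show ?thesis
    by (simp add: span_seminorm_def m_def M_def)
qed

text \<open>
  The normalisation subtracts the minimum rather than the value at a fixed state, so that
  the relative values lie in the box between \<open>0\<close> and the bound on the span.
\<close>

lemma average_solution_of_bounded_span:
  assumes fp: "\<And>\<gamma> s. 0 < \<gamma> \<Longrightarrow> \<gamma> < 1 \<Longrightarrow> v \<gamma> s = T (\<lambda>s'. \<gamma> * v \<gamma> s') s"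
    and span: "\<And>\<gamma>. 0 < \<gamma> \<Longrightarrow> \<gamma> < 1 \<Longrightarrow> span_seminorm (v \<gamma>) \<le> B"
  shows "\<exists>u \<alpha>. \<alpha> \<in> {0..1} \<and> (\<forall>s. u s = T (\<lambda>s'. u s' - \<alpha>) s)"
proof -
  define \<gamma> :: "nat \<Rightarrow> real" where "\<gamma> n = 1 - inverse (real (Suc (Suc n)))" for n
  have \<gamma>: "0 < \<gamma> n" "\<gamma> n < 1" for n
    by (auto simp: \<gamma>_def field_simps)
  have "\<gamma> \<longlonglongrightarrow> 1 - 0"
    unfolding \<gamma>_def by (intro tendsto_diff tendsto_const LIMSEQ_Suc[OF LIMSEQ_inverse_real_of_nat])
  then have \<gamma>_lim: "\<gamma> \<longlonglongrightarrow> 1"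
    by simp
  define m where "m n = Min (range (v (\<gamma> n)))" for n
  define h where "h n s = v (\<gamma> n) s - m n" for n s
  define a where "a n = (1 - \<gamma> n) * m n" for n
  have h_eq: "h n s = T (\<lambda>s'. \<gamma> n * h n s' - a n) s" for n s
  proof -
    have "(\<lambda>s'. \<gamma> n * h n s' - a n) = (\<lambda>s'. \<gamma> n * v (\<gamma> n) s' + (- m n))"
      by (auto simp: h_def a_def algebra_simps)
    then show ?thesis
      using fp[OF \<gamma>, of n s] add_const[of "\<lambda>s'. \<gamma> n * v (\<gamma> n) s'" "- m n" s] by (simp add: h_def)
  qed
  have h_range: "h n s \<in> {0..B}" for n s
  proof -
    have "v (\<gamma> n) s \<le> Max (range (v (\<gamma> n)))" "m n \<le> v (\<gamma> n) s"
      unfolding m_def by auto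
    then show ?thesis
      using span[OF \<gamma>, of n] unfolding h_def m_def span_seminorm_def atLeastAtMost_iff by linarith
  qed
  have a_range: "a n \<in> {0..1}" for n
  proof -
    have "m n \<in> range (v (\<gamma> n))"
      unfolding m_def by (rule Min_in) auto
    then obtain t where "m n = v (\<gamma> n) t"
      by auto
    then have "0 \<le> m n" "m n \<le> 1 / (1 - \<gamma> n)"
      using discounted_bounds[of "\<gamma> n" "v (\<gamma> n)" t, OF \<gamma> fp[OF \<gamma>]] by simp_all
    then show ?thesis
      using \<gamma>[of n] by (simp add: a_def pos_le_divide_eq mult.commute)
  qed
  \<comment> \<open>Packing into a Euclidean space gives one subsequence for all states and the gain.\<close>
  let ?S = "cbox 0 (\<chi> s::'s. B) \<times> {0..1::real}"
  have "compact ?S"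
    by (intro compact_Times compact_cbox compact_Icc)
  then have "seq_compact ?S"
    by (simp add: compact_eq_seq_compact_metric)
  moreover have "\<forall>n. ((\<chi> s. h n s), a n) \<in> ?S"
    using h_range a_range by (auto simp: mem_box_cart)
  ultimately obtain l \<sigma> where l: "l \<in> ?S" and \<sigma>: "strict_mono (\<sigma> :: nat \<Rightarrow> nat)"
    and lim: "((\<lambda>n. ((\<chi> s. h n s), a n)) \<circ> \<sigma>) \<longlonglongrightarrow> l"
    by (rule seq_compactE)
  define u where "u s = fst l $ s" for s
  define \<alpha> where "\<alpha> = snd l"
  have u: "(\<lambda>n. h (\<sigma> n) s) \<longlonglongrightarrow> u s" for s
    using tendsto_vec_nth[OF tendsto_fst[OF lim], of s] by (simp add: u_def o_def)
  have \<alpha>: "(\<lambda>n. a (\<sigma> n)) \<longlonglongrightarrow> \<alpha>"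
    using tendsto_snd[OF lim] by (simp add: \<alpha>_def o_def)
  have \<gamma>\<sigma>: "(\<lambda>n. \<gamma> (\<sigma> n)) \<longlonglongrightarrow> 1"
    using LIMSEQ_subseq_LIMSEQ[OF \<gamma>_lim \<sigma>] by (simp add: o_def)
  have "u s = T (\<lambda>s'. 1 * u s' - \<alpha>) s" for s
  proof (rule LIMSEQ_unique[OF u])
    have "(\<lambda>n. T (\<lambda>s'. \<gamma> (\<sigma> n) * h (\<sigma> n) s' - a (\<sigma> n)) s) \<longlonglongrightarrow> T (\<lambda>s'. 1 * u s' - \<alpha>) s"
      by (intro tendsto_pointwise tendsto_intros u \<alpha> \<gamma>\<sigma>)
    then show "(\<lambda>n. h (\<sigma> n) s) \<longlonglongrightarrow> T (\<lambda>s'. 1 * u s' - \<alpha>) s"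
      by (simp flip: h_eq)
  qed
  moreover have "\<alpha> \<in> {0..1}"
    using l by (auto simp: \<alpha>_def)
  ultimately show ?thesis
    by auto
qed

end

section \<open>The robust Bellman operator\<close>

definition expected_return ::
  "('s::finite \<Rightarrow> 'a::finite \<Rightarrow> real) \<Rightarrow> 's \<Rightarrow> 'a pmf \<Rightarrow> ('a \<Rightarrow> 's pmf) \<Rightarrow> ('s \<Rightarrow> real) \<Rightarrow> real" where
  "expected_return r s \<phi> p w =
     (\<Sum>a\<in>UNIV. \<Sum>s'\<in>UNIV. pmf \<phi> a * pmf (p a) s' * (r s a + w s'))"

definition robust_bellman ::
  "'a::finite pmf set \<Rightarrow> ('s::finite \<Rightarrow> ('a \<Rightarrow> 's pmf) set) \<Rightarrow> ('s \<Rightarrow> 'a \<Rightarrow> real)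
    \<Rightarrow> ('s \<Rightarrow> real) \<Rightarrow> 's \<Rightarrow> real" where
  "robust_bellman Q P r w s = (SUP \<phi>\<in>Q. INF p\<in>P s. expected_return r s \<phi> p w)"

lemma discounted_solution_iff:
  "discounted_solution Q P r \<gamma> v \<longleftrightarrow> (\<forall>s. v s = robust_bellman Q P r (\<lambda>s'. \<gamma> * v s') s)"
  by (simp add: discounted_solution_def robust_bellman_def expected_return_def)

lemma average_solution_iff:
  "average_solution Q P r u \<alpha> \<longleftrightarrow> (\<forall>s. u s = robust_bellman Q P r (\<lambda>s'. u s' - \<alpha>) s)"
  by (simp add: average_solution_def robust_bellman_def expected_return_def algebra_simps)

lemma sum_joint_pmf:
  fixes \<phi> :: "'a::finite pmf" and p :: "'a \<Rightarrow> 's::finite pmf"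
  shows "(\<Sum>a\<in>UNIV. \<Sum>s'\<in>UNIV. pmf \<phi> a * pmf (p a) s') = 1"
  by (simp flip: sum_distrib_left add: sum_pmf_eq_1)

lemma expected_return_le_add:
  assumes "\<And>s'. w s' \<le> w' s' + c"
  shows "expected_return r s \<phi> p w \<le> expected_return r s \<phi> p w' + c"
proof -
  have "expected_return r s \<phi> p w
      \<le> (\<Sum>a\<in>UNIV. \<Sum>s'\<in>UNIV. pmf \<phi> a * pmf (p a) s' * (r s a + w' s')
            + pmf \<phi> a * pmf (p a) s' * c)"
    unfolding expected_return_def
  proof (intro sum_mono)
    fix a s'
    show "pmf \<phi> a * pmf (p a) s' * (r s a + w s')
        \<le> pmf \<phi> a * pmf (p a) s' * (r s a + w' s') + pmf \<phi> a * pmf (p a) s' * c"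
      using mult_left_mono[OF assms[of s'], of "pmf \<phi> a * pmf (p a) s'"]
      by (simp add: algebra_simps)
  qed
  also have "\<dots> = expected_return r s \<phi> p w'
      + (\<Sum>a\<in>UNIV. \<Sum>s'\<in>UNIV. pmf \<phi> a * pmf (p a) s') * c"
    by (simp add: expected_return_def sum.distrib sum_distrib_right)
  finally show ?thesis
    by (simp add: sum_joint_pmf)
qed

lemma expected_return_zero:
  assumes "\<And>s a. r s a \<in> {0..1}"
  shows "expected_return r s \<phi> p (\<lambda>_. 0) \<in> {0..1}"
proof -
  have r: "0 \<le> r s a" "r s a \<le> 1" for a
    using assms[of s a] by auto
  have "expected_return r s \<phi> p (\<lambda>_. 0) \<le> (\<Sum>a\<in>UNIV. \<Sum>s'\<in>UNIV. pmf \<phi> a * pmf (p a) s')"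
    unfolding expected_return_def by (intro sum_mono) (simp add: mult_left_le r)
  moreover have "0 \<le> expected_return r s \<phi> p (\<lambda>_. 0)"
    unfolding expected_return_def by (intro sum_nonneg) (simp add: r)
  ultimately show ?thesis
    by (simp add: sum_joint_pmf)
qed

text \<open>
  Bounds uniform in \<open>\<phi>\<close> and \<open>p\<close> are what makes suprema and infima of reals behave: they yield the
  boundedness side conditions in the next two lemmas.
\<close>

lemma expected_return_bounded:
  fixes r :: "'s::finite \<Rightarrow> 'a::finite \<Rightarrow> real"
  assumes "\<And>s a. r s a \<in> {0..1}"
  obtains b where "\<And>\<phi> p. \<bar>expected_return r s \<phi> p w\<bar> \<le> b"
proof
  fix \<phi> :: "'a pmf" and p :: "'a \<Rightarrow> 's pmf"
  let ?d = "\<Sum>s\<in>UNIV. \<bar>w s\<bar>"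
  have "\<bar>w s\<bar> \<le> ?d" for s
    by (rule member_le_sum) auto
  then have "- ?d \<le> w s" "w s \<le> ?d" for s
    by (metis abs_le_iff minus_le_iff)+
  then have "expected_return r s \<phi> p w \<le> expected_return r s \<phi> p (\<lambda>_. 0) + ?d"
    "expected_return r s \<phi> p (\<lambda>_. 0) \<le> expected_return r s \<phi> p w + ?d"
    by (intro expected_return_le_add; simp add: minus_le_iff le_minus_iff; smt (verit))+
  then show "\<bar>expected_return r s \<phi> p w\<bar> \<le> 1 + ?d"
    using expected_return_zero[of r s \<phi> p] assms by auto
qed

lemma bdd_below_expected_return:
  assumes "\<And>s a. r s a \<in> {0..1}"
  shows "bdd_below ((\<lambda>p. expected_return r s \<phi> p w) ` A)"
proof -
  obtain b where b: "\<And>\<phi> p. \<bar>expected_return r s \<phi> p w\<bar> \<le> b"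
    using expected_return_bounded[of r s w] assms by blast
  then show ?thesis
    by (intro bdd_belowI2[of _ "- b"]) (metis abs_le_iff minus_le_iff)
qed

lemma bdd_above_INF_expected_return:
  assumes r: "\<And>s a. r s a \<in> {0..1}" and "A \<noteq> {}"
  shows "bdd_above ((\<lambda>\<phi>. INF p\<in>A. expected_return r s \<phi> p w) ` Q)"
proof -
  obtain b where b: "\<And>\<phi> p. \<bar>expected_return r s \<phi> p w\<bar> \<le> b"
    using expected_return_bounded[of r s w] r by blast
  obtain p where "p \<in> A"
    using \<open>A \<noteq> {}\<close> by blast
  then have "(INF p\<in>A. expected_return r s \<phi> p w) \<le> b" for \<phi>
    using cINF_lower[OF bdd_below_expected_return, of r p A s \<phi> w] r b[of \<phi> p] by fastforce
  then show ?thesis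
    by (intro bdd_aboveI2)
qed

lemma topical_operator_robust_bellman:
  fixes Q :: "'a::finite pmf set"
    and P :: "'s::finite \<Rightarrow> ('a \<Rightarrow> 's pmf) set"
  assumes r: "\<And>s a. r s a \<in> {0..1}"
    and Q: "Q \<noteq> {}"
    and P: "\<And>s. P s \<noteq> {}"
  shows "topical_operator (robust_bellman Q P r)"
proof
  fix w w' :: "'s \<Rightarrow> real" and c s
  assume le: "\<And>s. w s \<le> w' s + c"
  have inf: "(INF p\<in>P s. expected_return r s \<phi> p w) - c
      \<le> (INF p\<in>P s. expected_return r s \<phi> p w')" for \<phi>
  proof (rule cINF_greatest[OF P])
    fix p assume "p \<in> P s"
    then have "(INF p\<in>P s. expected_return r s \<phi> p w) \<le> expected_return r s \<phi> p w"
      by (rule cINF_lower[OF bdd_below_expected_return[OF r]])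
    also have "\<dots> \<le> expected_return r s \<phi> p w' + c"
      using le by (rule expected_return_le_add)
    finally show "(INF p\<in>P s. expected_return r s \<phi> p w) - c \<le> expected_return r s \<phi> p w'"
      by simp
  qed
  show "robust_bellman Q P r w s \<le> robust_bellman Q P r w' s + c"
    unfolding robust_bellman_def
  proof (rule cSUP_least[OF Q])
    fix \<phi> assume "\<phi> \<in> Q"
    then have "(INF p\<in>P s. expected_return r s \<phi> p w')
        \<le> (SUP \<phi>\<in>Q. INF p\<in>P s. expected_return r s \<phi> p w')"
      by (rule cSUP_upper[OF _ bdd_above_INF_expected_return[OF r P]])
    with inf[of \<phi>] show "(INF p\<in>P s. expected_return r s \<phi> p w)
        \<le> (SUP \<phi>\<in>Q. INF p\<in>P s. expected_return r s \<phi> p w') + c"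
      by simp
  qed
next
  fix s
  have zero: "expected_return r s \<phi> p (\<lambda>_. 0) \<in> {0..1}" for \<phi> p
    by (rule expected_return_zero[OF r])
  obtain \<phi> p where \<phi>: "\<phi> \<in> Q" and p: "p \<in> P s"
    using Q P by blast
  have "0 \<le> (INF p\<in>P s. expected_return r s \<phi> p (\<lambda>_. 0))"
    by (rule cINF_greatest[OF P]) (use zero in auto)
  also have "\<dots> \<le> robust_bellman Q P r (\<lambda>_. 0) s"
    unfolding robust_bellman_def
    by (rule cSUP_upper[OF \<phi> bdd_above_INF_expected_return[OF r P]])
  finally have "0 \<le> robust_bellman Q P r (\<lambda>_. 0) s" .
  moreover have "robust_bellman Q P r (\<lambda>_. 0) s \<le> 1"
    unfolding robust_bellman_def
  proof (rule cSUP_least[OF Q])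
    fix \<phi>
    show "(INF p\<in>P s. expected_return r s \<phi> p (\<lambda>_. 0)) \<le> 1"
      by (rule order_trans[OF cINF_lower[OF bdd_below_expected_return[OF r] p]])
        (use zero in auto)
  qed
  ultimately show "robust_bellman Q P r (\<lambda>_. 0) s \<in> {0..1}"
    by simp
qed

theorem theorem4:
  fixes Q :: "'a::finite pmf set"
    and P :: "'s::finite \<Rightarrow> ('a \<Rightarrow> 's pmf) set"
    and r :: "'s \<Rightarrow> 'a \<Rightarrow> real"
  assumes r_range: "\<And>s a. r s a \<in> {0..1}"
    and Q_nonempty: "Q \<noteq> {}"
    and P_nonempty: "\<And>s. P s \<noteq> {}"
  shows "bdd_above ((\<lambda>\<gamma>. span_seminorm (discounted_value Q P r \<gamma>)) ` {0<..<1})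
    \<longleftrightarrow> (\<exists>u \<alpha>. \<alpha> \<in> {0..1} \<and> average_solution Q P r u \<alpha>)"
proof -
  interpret topical_operator "robust_bellman Q P r"
    using assms by (rule topical_operator_robust_bellman)
  let ?v = "discounted_value Q P r"
  have v: "?v \<gamma> s = robust_bellman Q P r (\<lambda>s'. \<gamma> * ?v \<gamma> s') s" if \<gamma>: "0 < \<gamma>" "\<gamma> < 1" for \<gamma> s
  proof -
    have "\<exists>!v. discounted_solution Q P r \<gamma> v"
      unfolding discounted_solution_iff
      using discounted_exists[OF \<gamma>] discounted_unique[OF \<gamma>] by blast
    then have "discounted_solution Q P r \<gamma> (?v \<gamma>)"
      unfolding discounted_value_def by (rule theI')
    then show ?thesis
      unfolding discounted_solution_iff by (rule spec)
  qed
  show ?thesis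
  proof
    assume "bdd_above ((\<lambda>\<gamma>. span_seminorm (?v \<gamma>)) ` {0<..<1})"
    then obtain B where B: "\<And>\<gamma>. 0 < \<gamma> \<Longrightarrow> \<gamma> < 1 \<Longrightarrow> span_seminorm (?v \<gamma>) \<le> B"
      unfolding bdd_above_def ball_simps image_iff by force
    show "\<exists>u \<alpha>. \<alpha> \<in> {0..1} \<and> average_solution Q P r u \<alpha>"
      unfolding average_solution_iff by (rule average_solution_of_bounded_span[of ?v B]) (rule v B; assumption)+
  next
    assume "\<exists>u \<alpha>. \<alpha> \<in> {0..1} \<and> average_solution Q P r u \<alpha>"
    then obtain u \<alpha> where u: "\<And>s. u s = robust_bellman Q P r (\<lambda>s'. u s' - \<alpha>) s"
      unfolding average_solution_iff by blast
    have "span_seminorm (?v \<gamma>) \<le> 2 * span_seminorm u" if "0 < \<gamma>" "\<gamma> < 1" for \<gamma>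
      by (rule span_discounted_le[OF that v[OF that] u])
    then show "bdd_above ((\<lambda>\<gamma>. span_seminorm (?v \<gamma>)) ` {0<..<1})"
      by (intro bdd_aboveI2) auto
  qed
qed

end
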